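(* Let $k\ge 0$ be an integer, let $T_\tau=\{0=t^0<t^1<t^2<\dots\}$ be an increasing sequence of time points, and let $u\in P_k(T_\tau;\mathbb{V})$, with pieces $u^n=u|_{[t^{n-1},t^n]}\in P_k([t^{n-1},t^n];\mathbb{V})$ for $n\ge1$ and initial value $u^0(t^0)\in\mathrm{dom}(\mathcal{E})$, be a solution of the discontinuous Galerkin scheme $$\int_{t^{n-1}}^{t^n}\langle\mathcal{Q}(u^n(t))^*\partial_t u^n(t),v(t)\rangle_{\mathbb{V}^*\times\mathbb{V}}\,dt=\int_{t^{n-1}}^{t^n}\langle\mathcal{A}(u^n(t)),v(t)\rangle_{\mathbb{V}^*\times\mathbb{V}}\,dt-\langle\mathcal{Q}(u^n(t^{n-1}))^*(u^n(t^{n-1})-u^{n-1}(t^{n-1})),v(t^{n-1})\rangle_{\mathbb{V}^*\times\mathbb{V}}$$ for all $v\in P_k([t^{n-1},t^n];\mathbb{V})$ and all $n>0$. Here being a solution includes that all terms are well-defined, i.e., $u^n(t)\in\mathrm{dom}(\mathcal{A})\cap\mathrm{dom}(\mathcal{E})$ for all $t\in[t^{n-1},t^n]$, $n\ge1$, and the integrands are integrable. Then $$\mathcal{E}(u^n(t^n))\le\mathcal{E}(u^m(t^m))-\int_{t^m}^{t^n}\mathcal{D}(u(t))\,dt\qquad\text{for all integers }0\le m<n.$$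
   Context: Function spaces: $\mathbb{H}$ is a real Hilbert space with scalar product $\langle\cdot,\cdot\rangle$, identified with its dual $\mathbb{H}^*$. $\mathbb{V},\mathbb{W}\subset\mathbb{H}$ are reflexive Banach spaces, continuously and densely embedded in $\mathbb{H}$. Thus $\mathbb{V}\subset\mathbb{H}\subset\mathbb{V}^*$ and $\mathbb{W}\subset\mathbb{H}\subset\mathbb{W}^*$ are evolution triples with the same pivot space. In particular $\mathbb{V}\subset\mathbb{W}^*$, where $v\in\mathbb{V}$ is identified with the functional $w\mapsto\langle v,w\rangle$ on $\mathbb{W}$. Duality pairings are written $\langle\cdot,\cdot\rangle_{\mathbb{V}^*\times\mathbb{V}}$ and $\langle\cdot,\cdot\rangle_{\mathbb{W}^*\times\mathbb{W}}$. Energy: $\mathcal{E}:\mathbb{V}\to\mathbb{R}\cup\{+\infty\}$ is convex and proper, with essential domain $\mathrm{dom}(\mathcal{E})=\{u\in\mathbb{V}:\mathcal{E}(u)<\infty\}$. It is differentiable on its domain with respect to the topology of $\mathbb{W}^*$: for every $u\in\mathrm{dom}(\mathcal{E})$ there is a derivative $\mathcal{E}'(u)\in\mathbb{W}^{**}=\mathbb{W}$ such that $\mathcal{E}(v)=\mathcal{E}(u)+\langle v-u,\mathcal{E}'(u)\rangle_{\mathbb{W}^*\times\mathbb{W}}+o(\|v-u\|_{\mathbb{W}^*})$ as $v\to u$ in $\mathbb{W}^*$, $v\in\mathrm{dom}(\mathcal{E})$. Structural assumption: for every $u\in\mathrm{dom}(\mathcal{E})$ there is a given bounded linear operator $\mathcal{Q}(u):\mathbb{V}\to\mathbb{W}$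 such that $\mathcal{E}'(u)=\mathcal{Q}(u)u$. The adjoint $\mathcal{Q}(u)^*:\mathbb{W}^*\to\mathbb{V}^*$ is the bounded linear operator defined by $\langle\mathcal{Q}(u)^*w^*,v\rangle_{\mathbb{V}^*\times\mathbb{V}}=\langle w^*,\mathcal{Q}(u)v\rangle_{\mathbb{W}^*\times\mathbb{W}}$ for all $v\in\mathbb{V}$, $w^*\in\mathbb{W}^*$. Evolution operator and dissipation: $\mathcal{A}$ is a (possibly nonlinear) densely defined operator from $\mathrm{dom}(\mathcal{A})\subset\mathbb{V}$ to $\mathbb{V}^*$, and the dissipation functional is $\mathcal{D}(u):=-\langle\mathcal{A}(u),u\rangle_{\mathbb{V}^*\times\mathbb{V}}$ for $u\in\mathrm{dom}(\mathcal{A})$. No sign condition on $\mathcal{D}$ is assumed. Piecewise polynomials: $P_k([t^{n-1},t^n];\mathbb{V})=\{v: v(t)=a_0+a_1t+\dots+a_kt^k,\ a_j\in\mathbb{V}\}$ is the space of polynomials of degree at most $k$ on $[t^{n-1},t^n]$ with values in $\mathbb{V}$. $P_k(T_\tau;\mathbb{V})$ is the space of functions whose piece $u^n:=u|_{[t^{n-1},t^n]}$ belongs to $P_k([t^{n-1},t^n];\mathbb{V})$ for every $n\ge1$. Such functions may be discontinuous at the points $t^n$, $n>0$, where they have two values, $u^n(t^n)$ (limit from below) and $u^{n+1}(t^n)$ (limit from above). For $n=1$ the scheme involves the given initial value $u^0(t^0)$. In $\int_{t^m}^{t^n}\mathcal{D}(u(t))\,dt$, $u(t)=u^j(t)$ for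 $t\in(t^{j-1},t^j)$. *)

theory Defs
  imports "HOL-Analysis.Analysis" "HOL-Library.Landau_Symbols"
begin

text \<open>
  The topological dual of a normed space \<open>'a\<close> is the type \<open>'a \<Rightarrow>\<^sub>L real\<close> with its operator norm;
  the duality pairing of \<open>\<phi>\<close> and \<open>x\<close> is \<open>blinfun_apply \<phi> x\<close>.
\<close>

definition reflexive_space :: "'a::real_normed_vector itself \<Rightarrow> bool" where
  "reflexive_space _ \<longleftrightarrow>
     (\<forall>\<Phi> :: ('a \<Rightarrow>\<^sub>L real) \<Rightarrow>\<^sub>L real. \<exists>x::'a. \<forall>\<phi>. blinfun_apply \<Phi> \<phi> = blinfun_apply \<phi> x)"

text \<open>
  A continuous dense inclusion is represented by an injective bounded operator with dense range.
\<close>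

definition dense_embedding ::
  "('a::real_normed_vector \<Rightarrow>\<^sub>L 'h::real_normed_vector) \<Rightarrow> bool" where
  "dense_embedding i \<longleftrightarrow> inj (blinfun_apply i) \<and> closure (range (blinfun_apply i)) = UNIV"

text \<open>
  The inclusion \<open>V \<subseteq> W\<^sup>*\<close> through the common pivot space \<open>H\<close>.
\<close>

definition pivot ::
  "('v::real_normed_vector \<Rightarrow>\<^sub>L 'h::real_inner) \<Rightarrow> ('w::real_normed_vector \<Rightarrow>\<^sub>L 'h) \<Rightarrow> 'v \<Rightarrow> ('w \<Rightarrow>\<^sub>L real)" where
  "pivot iV iW v = blinfun_inner_right (iV v) o\<^sub>L iW"

lemma pivot_apply [simp]: "blinfun_apply (pivot iV iW v) w = iV v \<bullet> iW w"
  by (simp add: pivot_def)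

definition adjoint_op ::
  "('v::real_normed_vector \<Rightarrow>\<^sub>L 'w::real_normed_vector) \<Rightarrow> ('w \<Rightarrow>\<^sub>L real) \<Rightarrow>\<^sub>L ('v \<Rightarrow>\<^sub>L real)" where
  "adjoint_op S = Blinfun (\<lambda>\<phi>. \<phi> o\<^sub>L S)"

lemma adjoint_op_apply [simp]:
  "blinfun_apply (blinfun_apply (adjoint_op S) \<phi>) v = blinfun_apply \<phi> (blinfun_apply S v)"
  unfolding adjoint_op_def
  by (simp add: bounded_linear_Blinfun_apply
      bounded_bilinear.bounded_linear_left[OF bounded_bilinear_blinfun_compose])

definition edom :: "('a \<Rightarrow> ereal) \<Rightarrow> 'a set" where
  "edom E = {u. E u < \<infinity>}"

definition proper_fun :: "('a \<Rightarrow> ereal) \<Rightarrow> bool" where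
  "proper_fun E \<longleftrightarrow> (\<forall>u. E u \<noteq> -\<infinity>) \<and> edom E \<noteq> {}"

definition convex_fun :: "('a::real_vector \<Rightarrow> ereal) \<Rightarrow> bool" where
  "convex_fun E \<longleftrightarrow>
     (\<forall>x y. \<forall>s\<in>{0<..<1::real}.
        E ((1 - s) *\<^sub>R x + s *\<^sub>R y) \<le> ereal (1 - s) * E x + ereal s * E y)"

text \<open>
  Differentiability of \<open>E\<close> at \<open>u\<close> along its domain with respect to the (weaker) norm of \<open>W\<^sup>*\<close>.
  The filter expresses \<open>v \<rightarrow> u\<close> in \<open>W\<^sup>*\<close> with \<open>v\<close> in the domain; including \<open>v = u\<close> is harmless, since
  both sides of the Landau bound vanish there. The derivative lies in \<open>W\<^sup>*\<^sup>*\<close>, which is \<open>W\<close> by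
  reflexivity.
\<close>

definition has_dual_derivative ::
  "('v::real_normed_vector \<Rightarrow>\<^sub>L 'h::real_inner) \<Rightarrow> ('w::real_normed_vector \<Rightarrow>\<^sub>L 'h) \<Rightarrow>
   ('v \<Rightarrow> ereal) \<Rightarrow> 'v \<Rightarrow> 'w \<Rightarrow> bool" where
  "has_dual_derivative iV iW E u w \<longleftrightarrow>
     (\<lambda>v. real_of_ereal (E v) - real_of_ereal (E u) - blinfun_apply (pivot iV iW (v - u)) w)
       \<in> o[inf (filtercomap (pivot iV iW) (nhds (pivot iV iW u))) (principal (edom E))](\<lambda>v. norm (pivot iV iW (v - u)))"

definition dissipation :: "('v::real_normed_vector \<Rightarrow> ('v \<Rightarrow>\<^sub>L real)) \<Rightarrow> 'v \<Rightarrow> real" where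
  "dissipation A u = - blinfun_apply (A u) u"

text \<open>
  Polynomials of degree at most \<open>k\<close> on the set \<open>S\<close>; values outside \<open>S\<close> are irrelevant.
\<close>

definition poly_on :: "nat \<Rightarrow> real set \<Rightarrow> (real \<Rightarrow> 'v::real_normed_vector) set" where
  "poly_on k S = {v. \<exists>a :: nat \<Rightarrow> 'v. \<forall>t\<in>S. v t = (\<Sum>j\<le>k. t ^ j *\<^sub>R a j)}"

text \<open>
  A piecewise polynomial is represented by the family of its pieces \<open>u n\<close>, where \<open>u n\<close> for \<open>n \<ge> 1\<close>
  lives on \<open>{T (n - 1)..T n}\<close>; of \<open>u 0\<close> only the initial value \<open>u 0 (T 0)\<close> matters.
\<close>

definition pw_poly :: "nat \<Rightarrow> (nat \<Rightarrow> real) \<Rightarrow> (nat \<Rightarrow> real \<Rightarrow> 'v::real_normed_vector) \<Rightarrow> bool" where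
  "pw_poly k T u \<longleftrightarrow> (\<forall>n\<ge>1. u n \<in> poly_on k {T (n - 1)..T n})"

text \<open>
  The function on the union of the time intervals, equal to \<open>u j\<close> on the \<open>j\<close>-th open interval.
  Taking the value from below at the nodes is immaterial under integrals.
\<close>

definition glue :: "(nat \<Rightarrow> real) \<Rightarrow> (nat \<Rightarrow> real \<Rightarrow> 'v) \<Rightarrow> real \<Rightarrow> 'v" where
  "glue T u s = u (LEAST j. s \<le> T j) s"

lemma glue_eq:
  assumes "strict_mono T" "n \<ge> 1" "s \<in> {T (n - 1)<..<T n}"
  shows "glue T u s = u n s"
proof -
  have "(LEAST j. s \<le> T j) = n"
  proof (rule Least_equality)
    show "s \<le> T n" using assms by simp
    fix j assume "s \<le> T j"
    with assms(3) have "T (n - 1) < T j" by simp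
    with assms(1) have "n - 1 < j" by (simp add: strict_mono_less)
    then show "n \<le> j" by simp
  qed
  then show ?thesis by (simp add: glue_def)
qed

text \<open>
  The time derivative is one-sided at the end points of the interval.
\<close>

definition dG_solution ::
  "('v::real_normed_vector \<Rightarrow>\<^sub>L 'h::real_inner) \<Rightarrow> ('w::real_normed_vector \<Rightarrow>\<^sub>L 'h) \<Rightarrow>
   ('v \<Rightarrow> ereal) \<Rightarrow> ('v \<Rightarrow> ('v \<Rightarrow>\<^sub>L 'w)) \<Rightarrow> 'v set \<Rightarrow> ('v \<Rightarrow> ('v \<Rightarrow>\<^sub>L real)) \<Rightarrow>
   nat \<Rightarrow> (nat \<Rightarrow> real) \<Rightarrow> (nat \<Rightarrow> real \<Rightarrow> 'v) \<Rightarrow> bool" where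
  "dG_solution iV iW E Q domA A k T u \<longleftrightarrow>
     (\<forall>n\<ge>1. let I = {T (n - 1)..T n};
                lhs = (\<lambda>v t. blinfun_apply
                         (adjoint_op (Q (u n t)) (pivot iV iW (vector_derivative (u n) (at t within I)))) (v t));
                rhs = (\<lambda>v t. blinfun_apply (A (u n t)) (v t));
                s = T (n - 1)
       in (\<forall>t\<in>I. u n t \<in> domA \<inter> edom E) \<and>
          (\<forall>v\<in>poly_on k I.
             set_integrable lebesgue I (lhs v) \<and> set_integrable lebesgue I (rhs v) \<and>
             set_lebesgue_integral lebesgue I (lhs v) =
               set_lebesgue_integral lebesgue I (rhs v)
               - blinfun_apply (adjoint_op (Q (u n s)) (pivot iV iW (u n s - u (n - 1) s))) (v s)))"

end

theory Submission
  imports Defs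
begin

text \<open>
  Testing the scheme with \<open>v = u\<^sup>n\<close> turns its left-hand side into the integral of
  \<open>\<langle>\<partial>\<^sub>t u\<^sup>n, \<E>'(u\<^sup>n)\<rangle>\<close>, which by the chain rule is the increment of \<open>\<E>(u\<^sup>n)\<close>. The jump
  term is \<open>\<langle>u\<^sup>n - u\<^sup>n\<^sup>-\<^sup>1, \<E>'(u\<^sup>n)\<rangle>\<close> at the left node, and by convexity it dominates the
  jump of the energy there. Adding up the intervals gives the claim.
\<close>

lemma bounded_linear_pivot: "bounded_linear (pivot iV iW)"
  unfolding pivot_def
  by (rule bounded_linear_compose
        [OF bounded_bilinear.bounded_linear_left[OF bounded_bilinear_blinfun_compose]
            bounded_linear_compose[OF bounded_linear_blinfun_inner_right
              blinfun.bounded_linear_right]])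

text \<open>The expansion of \<open>E\<close> has an error small relative to the weak norm of the
  dual of \<open>W\<close>. A curve differentiable in the norm of \<open>V\<close> is also
  differentiable after the bounded map \<open>pivot iV iW\<close>, so its weak increments are of
  order \<open>s - t\<close> and the error becomes o(s - t). The expansion only sees points of
  \<open>edom E\<close>, hence the condition on the image of \<open>g\<close>.\<close>

lemma has_dual_derivative_chain:
  fixes g :: "real \<Rightarrow> 'v::real_normed_vector"
  assumes E: "has_dual_derivative iV iW E (g t) w"
    and g: "(g has_vector_derivative g') (at t within S)"
    and dom: "g ` S \<subseteq> edom E"
  shows "((\<lambda>s. real_of_ereal (E (g s))) has_vector_derivative blinfun_apply (pivot iV iW g') w)
    (at t within S)"
proof -
  let ?p = "pivot iV iW" and ?F = "at t within S"
  let ?e = "\<lambda>s. real_of_ereal (E (g s))"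
  interpret p: bounded_linear ?p by (rule bounded_linear_pivot)
  have "(g \<longlongrightarrow> g t) ?F"
    using has_vector_derivative_continuous[OF g] by (simp add: continuous_within)
  then have "((\<lambda>s. ?p (g s)) \<longlongrightarrow> ?p (g t)) ?F"
    by (rule p.tendsto)
  then have "filterlim g (filtercomap ?p (nhds (?p (g t)))) ?F"
    by (simp add: filterlim_filtercomap_iff o_def)
  moreover have "\<forall>\<^sub>F s in ?F. g s \<in> edom E"
    using dom by (auto simp: eventually_at_filter intro!: always_eventually)
  ultimately have lim: "filterlim g (inf (filtercomap ?p (nhds (?p (g t)))) (principal (edom E))) ?F"
    by (simp add: filterlim_inf filterlim_principal)
  have "(\<lambda>s. ?e s - ?e t - blinfun_apply (?p (g s - g t)) w) \<in> o[?F](\<lambda>s. norm (?p (g s - g t)))"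
    using landau_o.small.compose[OF E[unfolded has_dual_derivative_def] lim] by simp
  \<comment> \<open>Differentiability with tolerance 1, plus the triangle inequality, gives the
    constant \<open>1 + norm (?p g')\<close>.\<close>
  also have "(\<lambda>s. norm (?p (g s - g t))) \<in> O[?F](\<lambda>s. s - t)"
  proof -
    have "((\<lambda>s. ?p (g s)) has_vector_derivative ?p g') ?F"
      using g by (rule p.has_vector_derivative)
    then have "\<forall>\<^sub>F s in ?F. norm (?p (g s) - ?p (g t) - (s - t) *\<^sub>R ?p g') \<le> 1 * norm (s - t)"
      unfolding has_vector_derivative_def has_derivative_within_alt2 by (meson zero_less_one)
    then have "\<forall>\<^sub>F s in ?F. norm (norm (?p (g s - g t))) \<le> (1 + norm (?p g')) * norm (s - t)"
    proof eventually_elim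
      case (elim s)
      have "norm (?p (g s) - ?p (g t)) \<le>
          norm ((s - t) *\<^sub>R ?p g') + norm (?p (g s) - ?p (g t) - (s - t) *\<^sub>R ?p g')"
        by (rule norm_triangle_sub)
      with elim show ?case
        by (simp add: p.diff distrib_right mult.commute[of "norm (?p g')"])
    qed
    then show ?thesis by (rule bigoI)
  qed
  finally have r: "((\<lambda>s. (?e s - ?e t - blinfun_apply (?p (g s - g t)) w) / (s - t)) \<longlongrightarrow> 0) ?F"
    by (rule smalloD_tendsto)
  have "((\<lambda>s. blinfun_apply (?p (g s)) w) has_vector_derivative blinfun_apply (?p g') w) ?F"
    by (rule bounded_linear.has_vector_derivative[OF blinfun.bounded_linear_left
          p.has_vector_derivative[OF g]])
  then have "((\<lambda>s. (blinfun_apply (?p (g s)) w - blinfun_apply (?p (g t)) w) / (s - t))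
      \<longlongrightarrow> blinfun_apply (?p g') w) ?F"
    by (simp flip: has_real_derivative_iff_has_vector_derivative add: has_field_derivative_iff)
  from tendsto_add[OF r this]
  have "((\<lambda>s. (?e s - ?e t) / (s - t)) \<longlongrightarrow> blinfun_apply (?p g') w) ?F"
    by (simp add: p.diff blinfun.diff_left flip: add_divide_distrib)
  then show ?thesis
    by (simp flip: has_real_derivative_iff_has_vector_derivative add: has_field_derivative_iff)
qed

text \<open>Since \<open>real_of_ereal\<close> sends both infinities to 0, inequalities between real
  parts say something about \<open>E\<close> only where \<open>E\<close> is known to be
  finite.\<close>

lemma edom_ereal:
  assumes "proper_fun E" "x \<in> edom E"
  obtains r where "E x = ereal r"
  using assms by (cases "E x") (auto simp: proper_fun_def edom_def)

text \<open>Convexity bounds the difference quotients of \<open>E\<close> along the segment from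
  \<open>x\<close> to \<open>y\<close> by \<open>E y - E x\<close>; by the chain rule at the left
  end of the segment they converge to the pairing.\<close>

lemma dual_subgradient:
  fixes E :: "'v::real_normed_vector \<Rightarrow> ereal"
  assumes cvx: "convex_fun E" and proper: "proper_fun E"
    and der: "has_dual_derivative iV iW E x w"
    and x: "x \<in> edom E" and y: "y \<in> edom E"
  shows "blinfun_apply (pivot iV iW (y - x)) w \<le> real_of_ereal (E y) - real_of_ereal (E x)"
proof -
  obtain a b where a: "E x = ereal a" and b: "E y = ereal b"
    using edom_ereal[OF proper x] edom_ereal[OF proper y] by metis
  let ?g = "\<lambda>s::real. x + s *\<^sub>R (y - x)"
  \<comment> \<open>\<open>convex_fun\<close> speaks of interior parameters only, so the end points
    are added by hand. The bound is finite, which keeps the whole segment in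
    \<open>edom E\<close>.\<close>
  have le: "E (?g s) \<le> ereal (a + s * (b - a))" if "s \<in> {0..1}" for s
  proof (cases "s \<in> {0<..<1}")
    case True
    have "?g s = (1 - s) *\<^sub>R x + s *\<^sub>R y"
      by (simp add: algebra_simps)
    with True cvx have "E (?g s) \<le> ereal (1 - s) * E x + ereal s * E y"
      unfolding convex_fun_def by metis
    then show ?thesis
      by (simp add: a b algebra_simps)
  next
    case False
    with that have "s = 0 \<or> s = 1" by auto
    with a b show ?thesis by auto
  qed
  have dom: "?g ` {0..1} \<subseteq> edom E"
    using le by (force simp: edom_def dest: order.strict_trans1)
  have "(?g has_vector_derivative (y - x)) (at 0 within {0..1})"
    by (auto intro!: derivative_eq_intros)
  with has_dual_derivative_chain[where g = ?g and t = 0 and S = "{0..1}"] der dom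
  have "((\<lambda>s. real_of_ereal (E (?g s))) has_vector_derivative
      blinfun_apply (pivot iV iW (y - x)) w) (at 0 within {0..1})"
    by simp
  then have lim: "((\<lambda>s. (real_of_ereal (E (?g s)) - a) / s) \<longlongrightarrow> blinfun_apply (pivot iV iW (y - x)) w)
      (at 0 within {0..1})"
    by (simp flip: has_real_derivative_iff_has_vector_derivative add: has_field_derivative_iff a)
  have "(real_of_ereal (E (?g s)) - a) / s \<le> b - a" if s: "s \<in> {0..1}" "s \<noteq> 0" for s
  proof -
    obtain c where c: "E (?g s) = ereal c"
      using edom_ereal[OF proper] dom s(1) by blast
    with le[OF s(1)] s show ?thesis
      by (simp add: field_simps)
  qed
  then have "\<forall>\<^sub>F s in at 0 within {0..1}. (real_of_ereal (E (?g s)) - a) / s \<le> b - a"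
    by (auto simp: eventually_at_filter)
  moreover have "at (0::real) within {0..1} \<noteq> bot"
    by (simp add: at_within_Icc_at_right)
  ultimately show ?thesis
    using tendsto_upperbound[OF lim] by (simp add: a b)
qed

lemma poly_on_has_vector_derivative:
  assumes p: "p \<in> poly_on k {a..b}" and t: "t \<in> {a..b}" and "a < b"
  shows "(p has_vector_derivative vector_derivative p (at t within {a..b})) (at t within {a..b})"
proof -
  obtain c where c: "\<And>s. s \<in> {a..b} \<Longrightarrow> p s = (\<Sum>j\<le>k. s ^ j *\<^sub>R c j)"
    using p by (auto simp: poly_on_def)
  have "(\<lambda>s. \<Sum>j\<le>k. s ^ j *\<^sub>R c j) differentiable at t within {a..b}"
    by (intro differentiable_sum differentiable_scaleR differentiable_power) auto
  \<comment> \<open>Membership in \<open>poly_on\<close> fixes \<open>p\<close> on the interval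
    alone, so the derivative is taken within it, one-sided at the ends.\<close>
  then have "p differentiable at t within {a..b}"
    by (rule differentiable_transform_within[where d = 1]) (use t c in auto)
  then show ?thesis
    by (simp add: vector_derivative_works)
qed

lemma dG_solution_node_edom:
  assumes T: "strict_mono T" and u0: "u 0 (T 0) \<in> edom E"
    and sol: "dG_solution iV iW E Q domA A k T u"
  shows "u n (T n) \<in> edom E"
proof (cases n)
  case 0
  with u0 show ?thesis by simp
next
  case (Suc l)
  then show ?thesis
    using sol[unfolded dG_solution_def Let_def, rule_format, of n] strict_mono_less_eq[OF T, of l n]
    by auto
qed

text \<open>Integrability is part of the conclusion because the integrals are later added over
  adjacent intervals.\<close>

lemma dG_step:
  fixes E :: "'v::real_normed_vector \<Rightarrow> ereal"
  assumes cvx: "convex_fun E" and proper: "proper_fun E"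
    and der: "\<And>x. x \<in> edom E \<Longrightarrow> has_dual_derivative iV iW E x (blinfun_apply (Q x) x)"
    and T: "strict_mono T" and pw: "pw_poly k T u"
    and u0: "u 0 (T 0) \<in> edom E"
    and sol: "dG_solution iV iW E Q domA A k T u"
  defines "D \<equiv> \<lambda>t. dissipation A (glue T u t)"
  shows "set_integrable lebesgue {T n..T (Suc n)} D"
    and "real_of_ereal (E (u (Suc n) (T (Suc n)))) \<le>
      real_of_ereal (E (u n (T n))) - set_lebesgue_integral lebesgue {T n..T (Suc n)} D"
proof -
  let ?I = "{T n..T (Suc n)}" and ?u = "u (Suc n)"
  let ?e = "\<lambda>t. real_of_ereal (E (?u t))"
  \<comment> \<open>These are the left-hand integrand and the jump term for the test function
    \<open>?u\<close>, with the adjoint moved back: what remains is the pairing with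
    \<open>Q x x\<close>, the derivative of \<open>E\<close>.\<close>
  let ?d = "\<lambda>t. blinfun_apply (pivot iV iW (vector_derivative ?u (at t within ?I)))
    (blinfun_apply (Q (?u t)) (?u t))"
  let ?J = "blinfun_apply (pivot iV iW (?u (T n) - u n (T n))) (blinfun_apply (Q (?u (T n))) (?u (T n)))"
  have less: "T n < T (Suc n)" using T by (simp add: strict_mono_less)
  have poly: "?u \<in> poly_on k ?I"
    using pw unfolding pw_poly_def by (metis diff_Suc_1 le_add1 plus_1_eq_Suc)
  note step = sol[unfolded dG_solution_def Let_def, rule_format, of "Suc n", simplified]
  have dom: "?u t \<in> edom E" if "t \<in> ?I" for t using step that by auto
  \<comment> \<open>The piece \<open>?u\<close> is an admissible test function since trial and test
    space coincide.\<close>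
  have intd: "set_integrable lebesgue ?I ?d"
    and intA: "set_integrable lebesgue ?I (\<lambda>t. blinfun_apply (A (?u t)) (?u t))"
    and eq: "set_lebesgue_integral lebesgue ?I ?d =
      set_lebesgue_integral lebesgue ?I (\<lambda>t. blinfun_apply (A (?u t)) (?u t)) - ?J"
    using step poly by auto
  have "(?e has_vector_derivative ?d t) (at t within ?I)" if "t \<in> ?I" for t
    using that dom less
    by (intro has_dual_derivative_chain der poly_on_has_vector_derivative[OF poly]) auto
  \<comment> \<open>The fundamental theorem for the gauge integral needs no continuity of
    \<open>?d\<close>; \<open>intd\<close> then identifies the value with the Lebesgue
    integral.\<close>
  then have "(?d has_integral ?e (T (Suc n)) - ?e (T n)) ?I"
    using less by (intro fundamental_theorem_of_calculus) auto
  then have inc: "set_lebesgue_integral lebesgue ?I ?d = ?e (T (Suc n)) - ?e (T n)"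
    using set_lebesgue_integral_eq_integral(2)[OF intd] by (simp add: integral_unique)
  \<comment> \<open>At \<open>T n\<close> the function \<open>glue T u\<close> takes the value of
    the earlier piece. The two nodes form a null set, so they affect neither integrability nor the
    integral.\<close>
  have Deq: "D t = - blinfun_apply (A (?u t)) (?u t)" if "t \<in> ?I - {T n, T (Suc n)}" for t
    using glue_eq[OF T, of "Suc n" t u] that by (simp add: D_def dissipation_def)
  have neg: "set_integrable lebesgue ?I (\<lambda>t. - blinfun_apply (A (?u t)) (?u t))"
    using intA by (simp add: set_integrable_def)
  show intD: "set_integrable lebesgue ?I D"
    by (rule absolutely_integrable_spike[OF neg, of "{T n, T (Suc n)}"]) (auto simp: Deq)
  have "integral ?I D = integral ?I (\<lambda>t. - blinfun_apply (A (?u t)) (?u t))"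
    by (rule integral_spike[of "{T n, T (Suc n)}"]) (auto simp: Deq)
  then have diss: "set_lebesgue_integral lebesgue ?I D =
      - set_lebesgue_integral lebesgue ?I (\<lambda>t. blinfun_apply (A (?u t)) (?u t))"
    using set_lebesgue_integral_eq_integral(2)[OF intD] set_lebesgue_integral_eq_integral(2)[OF intA]
    by simp
  have prev: "u n (T n) \<in> edom E"
    using T u0 sol by (rule dG_solution_node_edom)
  \<comment> \<open>The subgradient is taken at the value after the jump, where the scheme evaluates
    \<open>Q\<close>, and tested against the value before the jump; this reverses the sign of
    \<open>?J\<close>.\<close>
  have "- ?J \<le> real_of_ereal (E (u n (T n))) - ?e (T n)"
    using dual_subgradient[OF cvx proper der[OF dom] dom prev, of "T n"] less
    by (simp add: inner_diff_left blinfun.diff_right)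
  then show "?e (T (Suc n)) \<le>
      real_of_ereal (E (u n (T n))) - set_lebesgue_integral lebesgue ?I D"
    using eq inc diss by linarith
qed

theorem theorem3:
  fixes iV :: "'v::banach \<Rightarrow>\<^sub>L 'h::{real_inner, complete_space}"
    and iW :: "'w::banach \<Rightarrow>\<^sub>L 'h"
    and E :: "'v \<Rightarrow> ereal"
    and E' :: "'v \<Rightarrow> 'w"
    and Q :: "'v \<Rightarrow> ('v \<Rightarrow>\<^sub>L 'w)"
    and domA :: "'v set"
    and A :: "'v \<Rightarrow> ('v \<Rightarrow>\<^sub>L real)"
    and k :: nat
    and T :: "nat \<Rightarrow> real"
    and u :: "nat \<Rightarrow> real \<Rightarrow> 'v"
  assumes "reflexive_space TYPE('v)" and "reflexive_space TYPE('w)"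
    and "dense_embedding iV" and "dense_embedding iW"
    and "convex_fun E" and "proper_fun E"
    and "\<And>x. x \<in> edom E \<Longrightarrow> has_dual_derivative iV iW E x (E' x)"
    and "\<And>x. x \<in> edom E \<Longrightarrow> E' x = blinfun_apply (Q x) x"
    and "closure domA = UNIV"
    and "T 0 = 0" and "strict_mono T"
    and "pw_poly k T u"
    and "u 0 (T 0) \<in> edom E"
    and "dG_solution iV iW E Q domA A k T u"
  shows "\<forall>m n. m < n \<longrightarrow>
    E (u n (T n)) \<le> E (u m (T m))
      - ereal (set_lebesgue_integral lebesgue {T m..T n} (\<lambda>t. dissipation A (glue T u t)))"
proof (intro allI impI)
  fix m n :: nat
  assume "m < n"
  let ?D = "\<lambda>t. dissipation A (glue T u t)"
  let ?e = "\<lambda>n. real_of_ereal (E (u n (T n)))"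
  have der: "has_dual_derivative iV iW E x (blinfun_apply (Q x) x)" if "x \<in> edom E" for x
    using assms(7,8)[OF that] by simp
  have dom: "u j (T j) \<in> edom E" for j
    using assms(11,13,14) by (rule dG_solution_node_edom)
  have "set_integrable lebesgue {T m..T n} ?D \<and>
    ?e n \<le> ?e m - set_lebesgue_integral lebesgue {T m..T n} ?D"
    using \<open>m < n\<close>[THEN less_imp_le]
  proof (induction rule: dec_induct)
    \<comment> \<open>The interval degenerates to a single point, so its integral vanishes.\<close>
    case base
    show ?case
      by (simp add: set_lebesgue_integral_eq_integral absolutely_integrable_negligible)
  next
    case (step j)
    let ?I = "{T m..T j}" and ?J = "{T j..T (Suc j)}"
    have le: "T m \<le> T j" "T j \<le> T (Suc j)"
      using step assms(11) by (simp_all add: strict_mono_less_eq)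
    then have un: "?I \<union> ?J = {T m..T (Suc j)}" by auto
    from step have int: "set_integrable lebesgue ?I ?D" by simp
    note intJ = dG_step(1)[OF assms(5,6) der assms(11-14), of j]
    have intU: "set_integrable lebesgue {T m..T (Suc j)} ?D"
      using set_integrable_Un[OF int intJ] un by simp
    \<comment> \<open>The closed intervals share the node \<open>T j\<close>, which the combination
      rule for gauge integrals permits.\<close>
    have "integral ?I ?D + integral ?J ?D = integral {T m..T (Suc j)} ?D"
      using le set_lebesgue_integral_eq_integral(1)[OF intU]
      by (rule Henstock_Kurzweil_Integration.integral_combine)
    then have "set_lebesgue_integral lebesgue {T m..T (Suc j)} ?D =
        set_lebesgue_integral lebesgue ?I ?D + set_lebesgue_integral lebesgue ?J ?D"
      using int intJ intU by (simp add: set_lebesgue_integral_eq_integral(2))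
    with step.IH dG_step(2)[OF assms(5,6) der assms(11-14), of j] intU show ?case
      by linarith
  qed
  moreover obtain a b where "E (u m (T m)) = ereal a" "E (u n (T n)) = ereal b"
    using edom_ereal[OF assms(6) dom] by metis
  ultimately show "E (u n (T n)) \<le> E (u m (T m))
      - ereal (set_lebesgue_integral lebesgue {T m..T n} ?D)"
    by simp
qed

end
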